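(* Let $\mathcal{A}$ be a Banach algebra such that $\mathrm{rad}(\mathcal{A})=\mathrm{rann}(\mathcal{A})$ and $\mathcal{A}/\mathrm{rad}(\mathcal{A})$ is commutative, and suppose $\mathcal{A}$ has a right identity. Let $d$ be a derivation of $\mathcal{A}$ and $k$ a positive integer. Then the following are equivalent: (i) $d=0$; (ii) $d$ is $k$-centralizing; (iii) $d$ is $k$-commuting.
   Context: $\mathrm{rad}(\mathcal{A})$ is the Jacobson radical and $\mathrm{rann}(\mathcal{A})=\{c\in\mathcal{A}: ac=0\ \forall a\in\mathcal{A}\}$. A derivation is a linear map $d$ with $d(ab)=d(a)b+ad(b)$. $Z(\mathcal{A})$ is the algebraic center of $\mathcal{A}$ and $[a,b]=ab-ba$. A map $T:\mathcal{A}\to\mathcal{A}$ is $k$-centralizing (resp. $k$-commuting) if $[T(a),a^k]\in Z(\mathcal{A})$ (resp. $[T(a),a^k]=0$) for all $a\in\mathcal{A}$. *)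

theory Defs
  imports "HOL-Analysis.Analysis"
begin

class complex_banach_algebra = real_normed_algebra + banach +
  fixes scaleC :: "complex \<Rightarrow> 'a \<Rightarrow> 'a"
  assumes scaleC_add_right: "scaleC c (x + y) = scaleC c x + scaleC c y"
    and scaleC_add_left: "scaleC (c + c') x = scaleC c x + scaleC c' x"
    and scaleC_scaleC: "scaleC c (scaleC c' x) = scaleC (c * c') x"
    and scaleC_one: "scaleC 1 x = x"
    and scaleR_scaleC: "scaleR r x = scaleC (complex_of_real r) x"
    and norm_scaleC: "norm (scaleC c x) = cmod c * norm x"
    and mult_scaleC_left: "scaleC c x * y = scaleC c (x * y)"
    and mult_scaleC_right: "x * scaleC c y = scaleC c (x * y)"

text \<open>Jacobson radical, via the standard characterisation for (possibly non-unital)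
algebras: x is in the radical iff a*x is quasi-invertible for every a.
Here y is a quasi-inverse of z iff z + y - z*y = 0 and z + y - y*z = 0.\<close>

definition quasi_invertible :: "'a::ring \<Rightarrow> bool" where
  "quasi_invertible z \<longleftrightarrow> (\<exists>y. z + y - z * y = 0 \<and> z + y - y * z = 0)"

definition jac_rad :: "'a::ring set" where
  "jac_rad = {x. \<forall>a. quasi_invertible (a * x)}"

definition rann :: "'a::ring set" where
  "rann = {c. \<forall>a. a * c = 0}"

definition alg_center :: "'a::ring set" where
  "alg_center = {z. \<forall>a. z * a = a * z}"

definition commutator :: "'a::ring \<Rightarrow> 'a \<Rightarrow> 'a" where
  "commutator a b = a * b - b * a"

definition derivation :: "('a::complex_banach_algebra \<Rightarrow> 'a) \<Rightarrow> bool" where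
  "derivation d \<longleftrightarrow>
     (\<forall>x y. d (x + y) = d x + d y) \<and>
     (\<forall>c x. d (scaleC c x) = scaleC c (d x)) \<and>
     (\<forall>a b. d (a * b) = d a * b + a * d b)"

text \<open>Positive powers in a possibly non-unital ring: npow a k = a^k for k >= 1
(the value for k = 0 is irrelevant and set to 0).\<close>

fun npow :: "'a::ring \<Rightarrow> nat \<Rightarrow> 'a" where
  "npow a 0 = 0"
| "npow a (Suc 0) = a"
| "npow a (Suc (Suc n)) = a * npow a (Suc n)"

definition k_centralizing :: "nat \<Rightarrow> ('a::ring \<Rightarrow> 'a) \<Rightarrow> bool" where
  "k_centralizing k T \<longleftrightarrow> (\<forall>a. commutator (T a) (npow a k) \<in> alg_center)"

definition k_commuting :: "nat \<Rightarrow> ('a::ring \<Rightarrow> 'a) \<Rightarrow> bool" where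
  "k_commuting k T \<longleftrightarrow> (\<forall>a. commutator (T a) (npow a k) = 0)"

end

theory Submission
  imports Defs "HOL-Computational_Algebra.Fundamental_Theorem_Algebra"
begin

text \<open>Let \<open>e\<close> be a right identity. The corner \<open>e A\<close> is a commutative unital closed subalgebra that
  complements \<open>rann A = rad A\<close>, hence it is semisimple, and \<open>D x = e * d x\<close> is a derivation on it. By
  the theorems of Johnson and Singer-Wermer \<open>D = 0\<close>. Here is a proof without characters: a gliding
  hump argument shows that elements of the separating space of \<open>D\<close> have finite spectrum, hence are
  roots of polynomials with simple roots and killed by \<open>D\<close>; as the separating space is an ideal, its
  elements square to zero, so it is trivial and \<open>D\<close> is bounded. By the Kleinecke-Shirokov argument
  every \<open>D a\<close> is then quasinilpotent, that is, zero. Thus \<open>d\<close> maps into \<open>rann A\<close>, and \<open>d = 0\<close> follows by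
  testing \<open>k\<close>-commutation on the idempotents \<open>e\<close> and \<open>e + r\<close> with \<open>r\<close> in \<open>rann A\<close>.\<close>

section \<open>Complex scalars and sums over roots of unity\<close>

lemma scaleC_zero_left [simp]: "scaleC 0 (x::'a::complex_banach_algebra) = 0"
  using scaleC_add_left[of 0 0 x] by simp

lemma scaleC_zero_right [simp]: "scaleC c (0::'a::complex_banach_algebra) = 0"
  using scaleC_add_right[of c "0::'a" 0] by simp

lemma scaleC_minus_left: "scaleC (- c) (x::'a::complex_banach_algebra) = - scaleC c x"
  using scaleC_add_left[of c "-c" x] by (simp add: eq_neg_iff_add_eq_0 add.commute)

lemma scaleC_minus_right: "scaleC c (- x::'a::complex_banach_algebra) = - scaleC c x"
  using scaleC_add_right[of c x "-x"] by (simp add: eq_neg_iff_add_eq_0 add.commute)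

lemma scaleC_diff_left: "scaleC (c - c') (x::'a::complex_banach_algebra) = scaleC c x - scaleC c' x"
  using scaleC_add_left[of c "-c'" x] by (simp add: scaleC_minus_left)

lemma scaleC_diff_right: "scaleC c (x - y::'a::complex_banach_algebra) = scaleC c x - scaleC c y"
  using scaleC_add_right[of c x "-y"] by (simp add: scaleC_minus_right)

lemma scaleC_sum_left:
  "scaleC (\<Sum>i\<in>I. f i) (x::'a::complex_banach_algebra) = (\<Sum>i\<in>I. scaleC (f i) x)"
  by (induction I rule: infinite_finite_induct) (auto simp: scaleC_add_left)

lemma cis_root_power: "n > 0 \<Longrightarrow> cis (2 * pi / real n) ^ n = 1"
  by (subst Complex.DeMoivre) simp

text \<open>Orthogonality of the roots of unity: a geometric sum whose ratio, the
  \<open>i\<close>-th power of a primitive root, differs from 1 for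
  \<open>0 < i < n\<close>.\<close>

lemma sum_powers_roots_unity:
  assumes "i < n"
  shows "(\<Sum>k<n. (cis (2 * pi / n) ^ k) ^ i) = (if i = 0 then of_nat n else 0)"
proof (cases "i = 0")
  case False
  let ?z = "cis (2 * pi / n) ^ i"
  have "inj_on (\<lambda>k. cis (2 * pi * real k / real n)) {..<n}"
    using Complex.bij_betw_roots_unity[of n] assms by (auto simp: bij_betw_def)
  then have "cis (2 * pi * real i / real n) \<noteq> cis (2 * pi * real 0 / real n)"
    using assms False by (metis inj_on_def lessThan_iff gr_zeroI less_nat_zero_code)
  then have ne: "?z \<noteq> 1"
    by (subst Complex.DeMoivre) (simp add: mult_ac)
  have "(\<Sum>k<n. (cis (2 * pi / n) ^ k) ^ i) = (\<Sum>k<n. ?z ^ k)"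
    by (simp add: power_mult[symmetric] mult.commute)
  also have "\<dots> = (?z ^ n - 1) / (?z - 1)"
    using ne by (rule geometric_sum)
  also have "?z ^ n = (cis (2 * pi / n) ^ n) ^ i"
    by (simp add: power_mult[symmetric] mult.commute)
  also have "cis (2 * pi / n) ^ n = 1"
    using assms by (intro cis_root_power) simp
  finally show ?thesis using False by simp
qed simp

section \<open>The commutative unital corner\<close>

text \<open>\<open>comm_below\<close> is commutativity modulo \<open>rann\<close>: every commutator
  is annihilated by multiplication from the left.\<close>

locale right_unital_algebra =
  fixes e :: "'a::complex_banach_algebra"
  assumes mult_unit [simp]: "x * e = x"
    and comm_below: "(z::'a) * (x * y) = z * (y * x)"
begin

text \<open>Since \<open>e\<close> is idempotent, the fixed points of left multiplication by
  \<open>e\<close> form the right ideal \<open>e A\<close>, on which \<open>e\<close> is a two-sided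
  unit.\<close>

definition corner :: "'a set" where
  "corner = {x. e * x = x}"

lemma unit_mult: "x \<in> corner \<Longrightarrow> e * x = x"
  by (simp add: corner_def)

lemma unit_in_corner [simp]: "e \<in> corner"
  by (simp add: corner_def)

lemma corner_zero [simp]: "0 \<in> corner"
  by (simp add: corner_def)

lemma corner_mult [simp]: "x \<in> corner \<Longrightarrow> x * y \<in> corner"
  by (simp add: corner_def mult.assoc[symmetric])

lemma corner_add [simp]: "x \<in> corner \<Longrightarrow> y \<in> corner \<Longrightarrow> x + y \<in> corner"
  by (simp add: corner_def distrib_left)

lemma corner_minus [simp]: "x \<in> corner \<Longrightarrow> - x \<in> corner"
  by (simp add: corner_def)

lemma corner_diff [simp]: "x \<in> corner \<Longrightarrow> y \<in> corner \<Longrightarrow> x - y \<in> corner"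
  by (simp add: corner_def right_diff_distrib)

lemma corner_scaleC [simp]: "x \<in> corner \<Longrightarrow> scaleC c x \<in> corner"
  by (simp add: corner_def mult_scaleC_right)

lemma corner_scaleR [simp]: "x \<in> corner \<Longrightarrow> scaleR c x \<in> corner"
  by (simp add: corner_def)

lemma corner_sum [simp]: "(\<And>i. i \<in> I \<Longrightarrow> f i \<in> corner) \<Longrightarrow> sum f I \<in> corner"
  by (induction I rule: infinite_finite_induct) auto

lemma corner_comm: "x \<in> corner \<Longrightarrow> y \<in> corner \<Longrightarrow> x * y = y * x"
  using comm_below[of e x y] by (metis corner_mult unit_mult)

lemma corner_limit: "f \<longlonglongrightarrow> y \<Longrightarrow> (\<And>n. f n \<in> corner) \<Longrightarrow> y \<in> corner"
  using tendsto_mult[OF tendsto_const[of e], of f y sequentially] LIMSEQ_unique[of f]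
  by (simp add: corner_def)

section \<open>Powers and polynomial calculus in the corner\<close>

text \<open>The type class has no unit, so powers are built by hand, starting from
  \<open>e\<close>.\<close>

definition pw :: "'a \<Rightarrow> nat \<Rightarrow> 'a" where
  "pw x n = (((*) x) ^^ n) e"

lemma pw_0 [simp]: "pw x 0 = e" and pw_Suc: "pw x (Suc n) = x * pw x n"
  by (simp_all add: pw_def)

lemma pw_corner [simp]: "x \<in> corner \<Longrightarrow> pw x n \<in> corner"
  by (cases n) (auto simp: pw_Suc)

lemma norm_pw_le: "norm (pw x n) \<le> norm x ^ n * norm e"
proof (induction n)
  case (Suc n)
  have "norm (pw x (Suc n)) \<le> norm x * norm (pw x n)"
    by (simp add: pw_Suc norm_mult_ineq)
  also have "\<dots> \<le> norm x * (norm x ^ n * norm e)"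
    by (intro mult_left_mono Suc) auto
  finally show ?case by (simp add: mult.assoc)
qed simp

lemma pw_scaleC: "pw (scaleC c x) n = scaleC (c ^ n) (pw x n)"
  by (induction n)
    (auto simp: pw_Suc scaleC_one mult_scaleC_left mult_scaleC_right scaleC_scaleC mult.commute)

lemma pw_mult: "x \<in> corner \<Longrightarrow> y \<in> corner \<Longrightarrow> pw (x * y) n = pw x n * pw y n"
proof (induction n)
  case (Suc n)
  then have "pw (x * y) (Suc n) = x * (y * pw x n) * pw y n"
    by (simp add: pw_Suc mult.assoc)
  also have "\<dots> = x * (pw x n * y) * pw y n"
    by (simp only: comm_below)
  finally show ?case by (simp add: pw_Suc mult.assoc)
qed (simp add: unit_mult)

text \<open>Evaluation of a polynomial in Horner form with \<open>e\<close> as unit. On the corner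
  it is a ring homomorphism, which carries polynomial identities and divisibility over to the
  algebra.\<close>

definition ev :: "complex poly \<Rightarrow> 'a \<Rightarrow> 'a" where
  "ev p x = fold_coeffs (\<lambda>c y. scaleC c e + x * y) p 0"

lemma ev_0 [simp]: "ev 0 x = 0"
  by (simp add: ev_def)

lemma ev_pCons [simp]: "ev (pCons c p) x = scaleC c e + x * ev p x"
  by (cases "p = 0 \<and> c = 0") (auto simp: ev_def)

lemma ev_1 [simp]: "ev 1 x = e"
  by (simp add: one_pCons scaleC_one)

lemma ev_corner [simp]: "x \<in> corner \<Longrightarrow> ev p x \<in> corner"
  by (induction p) auto

lemma ev_add: "ev (p + q) x = ev p x + ev q x"
proof (induction p arbitrary: q)
  case (pCons a p)
  then show ?case
    by (cases q) (auto simp: scaleC_add_left distrib_left)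
qed simp

lemma ev_smult: "ev (smult c p) x = scaleC c (ev p x)"
  by (induction p) (auto simp: scaleC_scaleC scaleC_add_right mult_scaleC_right)

lemma ev_minus: "ev (- p) x = - ev p x"
  using ev_add[of p "-p" x] by (simp add: eq_neg_iff_add_eq_0 add.commute)

lemma ev_diff: "ev (p - q) x = ev p x - ev q x"
  using ev_add[of p "-q" x] by (simp add: ev_minus)

lemma ev_mult: "x \<in> corner \<Longrightarrow> ev (p * q) x = ev p x * ev q x"
  by (induction p)
    (auto simp: ev_add ev_smult mult_scaleC_left unit_mult distrib_right mult.assoc)

lemma ev_power: "x \<in> corner \<Longrightarrow> ev (p ^ n) x = pw (ev p x) n"
  by (induction n) (auto simp: ev_mult pw_Suc)

lemma ev_X [simp]: "ev [:0, 1:] x = x"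
  by (simp add: scaleC_one)

lemma ev_sum: "ev (sum p I) x = (\<Sum>i\<in>I. ev (p i) x)"
  by (induction I rule: infinite_finite_induct) (auto simp: ev_add)

section \<open>Invertibility and Neumann series\<close>

definition cinv :: "'a \<Rightarrow> bool" where
  "cinv x \<longleftrightarrow> (\<exists>y\<in>corner. x * y = e)"

lemma cinv_factor: "y \<in> corner \<Longrightarrow> cinv (x * y) \<Longrightarrow> cinv x"
  unfolding cinv_def by (metis corner_mult mult.assoc)

lemma cinv_mult:
  assumes "x \<in> corner" "cinv x" "cinv y"
  shows "cinv (x * y)"
proof -
  obtain x' y' where *: "x' \<in> corner" "x * x' = e" "y' \<in> corner" "y * y' = e"
    using assms by (auto simp: cinv_def)
  have "x * y * (y' * x') = x * (y * y') * x'"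
    by (simp only: mult.assoc)
  then show ?thesis
    using * corner_mult mult_unit by (metis cinv_def)
qed

lemma cinv_scaleC: "c \<noteq> 0 \<Longrightarrow> cinv x \<Longrightarrow> cinv (scaleC c x)"
  unfolding cinv_def
  by (metis corner_scaleC mult_scaleC_left mult_scaleC_right scaleC_scaleC scaleC_one
      right_inverse)

lemma cinv_unit [simp]: "cinv e"
  by (auto simp: cinv_def intro!: bexI[of _ e])

lemma cinv_ev_dvd: "x \<in> corner \<Longrightarrow> p dvd q \<Longrightarrow> cinv (ev q x) \<Longrightarrow> cinv (ev p x)"
  by (auto elim!: dvdE simp: ev_mult intro: cinv_factor[rotated])

text \<open>One half of the spectral mapping theorem: \<open>p\<close> splits into linear factors,
  and products of invertible elements are invertible.\<close>

lemma cinv_ev: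
  assumes x: "x \<in> corner" and "p \<noteq> 0"
    and "\<And>r. poly p r = 0 \<Longrightarrow> cinv (x - scaleC r e)"
  shows "cinv (ev p x)"
  using assms(2,3)
proof (induction "degree p" arbitrary: p)
  case 0
  then obtain c where "p = [:c:]" "c \<noteq> 0"
    by (metis degree_eq_zeroE pCons_0_0)
  then show ?case by (simp add: cinv_scaleC)
next
  case (Suc n)
  then obtain r where r: "poly p r = 0"
    using fundamental_theorem_of_algebra[of p] by (metis constant_degree nat.distinct(1))
  then obtain q where q: "p = [:-r, 1:] * q"
    by (metis dvdE poly_eq_0_iff_dvd)
  with Suc.prems have "q \<noteq> 0" by auto
  then have "degree p = Suc (degree q)"
    unfolding q by (subst degree_mult_eq) auto
  then have "cinv (ev q x)"
    using Suc \<open>q \<noteq> 0\<close> q by (intro Suc.hyps) auto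
  moreover have "ev [:-r, 1:] x = x - scaleC r e"
    by (simp add: scaleC_minus_left scaleC_one)
  ultimately show ?case
    using Suc.prems(2)[OF r] x unfolding q by (simp only: ev_mult[OF x]) (intro cinv_mult; simp)
qed

text \<open>The Neumann series of \<open>x\<close> converges in the closed corner and inverts
  \<open>e - x\<close>.\<close>

lemma cinv_unit_minus_small:
  assumes x: "x \<in> corner" and "norm x < 1"
  shows "cinv (e - x)"
proof -
  have "summable (\<lambda>n. norm x ^ n * norm e)"
    using assms by (intro summable_mult2 summable_geometric) simp
  then have sm: "summable (pw x)"
    by (rule summable_comparison_test') (rule norm_pw_le)
  define y where "y = suminf (pw x)"
  have y: "y \<in> corner"
    using summable_LIMSEQ[OF sm] unfolding y_def by (rule corner_limit) (use x in auto)
  have "x * y = (\<Sum>n. pw x (Suc n))"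
    unfolding y_def pw_Suc by (rule suminf_mult[OF sm, symmetric])
  also have "\<dots> = y - e"
    unfolding y_def by (subst suminf_split_head[OF sm]) simp
  finally have "(e - x) * y = e"
    using y by (simp add: left_diff_distrib unit_mult)
  then show ?thesis using y by (auto simp: cinv_def)
qed

text \<open>\<open>1 - X\<close> divides \<open>1 - X ^ n\<close>, so \<open>e - x\<close> is a
  factor of the invertible element \<open>e - pw x n\<close>.\<close>

lemma cinv_unit_minus_pw_small:
  assumes x: "x \<in> corner" and "norm (pw x n) < 1"
  shows "cinv (e - x)"
proof -
  have "cinv (ev (1 - [:0, 1:] ^ n) x)"
    using assms by (simp add: ev_diff ev_power cinv_unit_minus_small del: ev_pCons)
  moreover have "(1 - [:0, 1:]) dvd (1 - [:0, 1:] ^ n :: complex poly)"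
    by (metis dvd_triv_left one_diff_power_eq)
  ultimately have "cinv (ev (1 - [:0, 1:]) x)"
    using cinv_ev_dvd x by blast
  then show ?thesis by (simp add: ev_diff del: ev_pCons)
qed

section \<open>The resolvent and quasinilpotent elements\<close>

text \<open>Continuity comes from the resolvent identity \<open>res\<close>, obtained by writing
  \<open>f a\<close> and \<open>f b\<close> through the common products \<open>f b * f a\<close> and
  \<open>f b * (x * f a)\<close>.\<close>

lemma resolvent_continuous:
  assumes x: "x \<in> corner" and f: "\<And>c. f c \<in> corner" "\<And>c. (e - scaleC c x) * f c = e"
  shows "continuous_on UNIV f"
proof -
  have res: "f a - f b = scaleC (a - b) (f b * (x * f a))" for a b
  proof -
    have "f a * ((e - scaleC b x) * f b) = f a * f b - scaleC b (f a * (x * f b))"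
      using f(1) by (simp add: left_diff_distrib right_diff_distrib unit_mult
          mult_scaleC_left mult_scaleC_right)
    moreover have "f b * ((e - scaleC a x) * f a) = f b * f a - scaleC a (f b * (x * f a))"
      using f(1) by (simp add: left_diff_distrib right_diff_distrib unit_mult
          mult_scaleC_left mult_scaleC_right)
    moreover have comm: "f a * f b = f b * f a"
      using f(1) by (simp add: corner_comm)
    moreover have "f a * (x * f b) = f b * (x * f a)"
      using arg_cong[OF comm, of "\<lambda>y. y * x"] by (simp add: mult.assoc comm_below[of _ _ x])
    ultimately have "f a = f b * f a - scaleC b (f b * (x * f a))"
      "f b = f b * f a - scaleC a (f b * (x * f a))"
      by (simp_all add: f(2))
    moreover have "u - v = t - s" if "u = q - s" "v = q - t" for u v q s t :: 'a
      using that by simp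
    ultimately show ?thesis
      unfolding scaleC_diff_left by blast
  qed
  have "(f \<longlongrightarrow> f b) (at b)" for b
  proof -
    define K where "K = norm (f b) * norm x"
    have K: "norm (f a - f b) \<le> cmod (a - b) * (K * norm (f a))" for a
    proof -
      have "norm (f b * (x * f a)) \<le> norm (f b) * (norm x * norm (f a))"
        by (intro order_trans[OF norm_mult_ineq] mult_left_mono norm_mult_ineq) auto
      then show ?thesis
        unfolding res[of a b] norm_scaleC K_def by (intro mult_left_mono) (auto simp: mult.assoc)
    qed
    have "((\<lambda>a. cmod (a - b) * K) \<longlongrightarrow> cmod (b - b) * K) (at b)"
      by (intro tendsto_intros)
    then have "\<forall>\<^sub>F a in at b. cmod (a - b) * K < 1/2"
      by (rule order_tendstoD) auto
    then have "\<forall>\<^sub>F a in at b. norm (f a - f b) \<le> cmod (a - b) * (K * (2 * norm (f b)))"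
    proof eventually_elim
      case (elim a)
      \<comment> \<open>Close to \<open>b\<close> the identity bounds \<open>norm (f a)\<close> by
        itself with factor 1/2, so that term can be absorbed.\<close>
      have "norm (f a) \<le> norm (f b) + norm (f a - f b)"
        by (metis add.commute diff_add_cancel norm_triangle_ineq)
      also have "\<dots> \<le> norm (f b) + cmod (a - b) * K * norm (f a)"
        using K[of a] by (simp add: mult.assoc)
      also have "\<dots> \<le> norm (f b) + 1/2 * norm (f a)"
        using elim by (intro add_left_mono mult_right_mono) auto
      finally have "norm (f a) \<le> 2 * norm (f b)"
        by simp
      moreover have "K \<ge> 0" by (simp add: K_def)
      ultimately have "cmod (a - b) * (K * norm (f a)) \<le> cmod (a - b) * (K * (2 * norm (f b)))"
        by (intro mult_left_mono) auto
      with K[of a] show ?case by linarith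
    qed
    moreover have "((\<lambda>a. cmod (a - b) * (K * (2 * norm (f b)))) \<longlongrightarrow>
        cmod (b - b) * (K * (2 * norm (f b)))) (at b)"
      by (intro tendsto_intros)
    ultimately have "((\<lambda>a. f a - f b) \<longlongrightarrow> 0) (at b)"
      by (intro Lim_null_comparison[of "\<lambda>a. f a - f b"]) auto
    then show ?thesis by (simp add: LIM_zero_iff)
  qed
  then show ?thesis by (simp add: continuous_on_def)
qed

text \<open>The partial fraction expansion of \<open>1 / (1 - T ^ n)\<close> over the
  \<open>n\<close>-th roots of unity, for \<open>T\<close> the element \<open>scaleC t x\<close>.
  Each summand contributes a geometric sum; in the total only the power 0 survives, by
  orthogonality.\<close>

lemma resolvent_average:
  assumes x: "x \<in> corner" and f: "\<And>c. f c \<in> corner" "\<And>c. (e - scaleC c x) * f c = e"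
    and n: "n > 0"
  shows "(e - pw (scaleC t x) n) *
    scaleC (1 / of_nat n) (\<Sum>k<n. f (cis (2 * pi / n) ^ k * t)) = e"
proof -
  let ?z = "cis (2 * pi / n)"
  have zn: "?z ^ n = 1"
    using n by (rule cis_root_power)
  have "(e - pw (scaleC t x) n) * f (?z ^ k * t) = (\<Sum>i<n. scaleC ((?z ^ k) ^ i * t ^ i) (pw x i))"
    (is "?L = ?R") for k
  proof -
    define c where "c = ?z ^ k * t"
    have "c ^ n = (?z ^ n) ^ k * t ^ n"
      by (simp add: c_def power_mult_distrib power_mult[symmetric] mult.commute)
    then have cn: "c ^ n = t ^ n" by (simp add: zn)
    define y where "y = scaleC c x"
    have y: "y \<in> corner" using x by (simp add: y_def)
    have "pw (scaleC t x) n = pw y n"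
      by (simp add: y_def pw_scaleC cn)
    \<comment> \<open>The geometric sum formula for polynomials, evaluated at
      \<open>y\<close>.\<close>
    moreover have "e - pw y n = (e - y) * (\<Sum>i<n. pw y i)"
      using arg_cong[OF one_diff_power_eq[of "[:0, 1:]::complex poly" n], of "\<lambda>p. ev p y"] y
      by (simp add: ev_diff ev_mult ev_power ev_sum del: ev_pCons)
    moreover have "(e - y) * (\<Sum>i<n. pw y i) * f c = (\<Sum>i<n. pw y i) * ((e - y) * f c)"
      using y f(1) by (metis corner_comm corner_diff corner_sum mult.assoc pw_corner unit_in_corner)
    ultimately have "?L = (\<Sum>i<n. pw y i)"
      using f(2)[of c] by (simp add: y_def c_def)
    also have "\<dots> = ?R"
      by (simp add: y_def pw_scaleC c_def power_mult_distrib)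
    finally show ?thesis .
  qed
  then have "(e - pw (scaleC t x) n) * (\<Sum>k<n. f (?z ^ k * t)) =
      (\<Sum>k<n. \<Sum>i<n. scaleC ((?z ^ k) ^ i * t ^ i) (pw x i))"
    by (simp add: sum_distrib_left)
  also have "\<dots> = (\<Sum>i<n. \<Sum>k<n. scaleC ((?z ^ k) ^ i * t ^ i) (pw x i))"
    by (rule sum.swap)
  also have "\<dots> = (\<Sum>i<n. scaleC ((\<Sum>k<n. (?z ^ k) ^ i) * t ^ i) (pw x i))"
    by (simp add: scaleC_sum_left sum_distrib_right)
  also have "\<dots> = (\<Sum>i<n. if i = 0 then scaleC (of_nat n) e else 0)"
    by (intro sum.cong refl, subst sum_powers_roots_unity) auto
  also have "\<dots> = scaleC (of_nat n) e"
    using n by (simp add: sum.delta)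
  finally show ?thesis
    using n by (simp add: mult_scaleC_right scaleC_scaleC scaleC_one)
qed

text \<open>\<open>F n t\<close> inverts \<open>e - p\<close>, where \<open>p\<close> is the
  \<open>n\<close>-th power of \<open>t x\<close>. Convergence at \<open>s\<close> forces
  \<open>F n s\<close> towards \<open>e\<close>, so eventually \<open>F n t\<close> is within 1/2 of
  \<open>e\<close>. Then \<open>p = (F n t - e) - p * (F n t - e)\<close> gives
  \<open>norm p \<le> 1/2 + norm p / 2\<close>, that is, \<open>norm p \<le> 1\<close>; for
  \<open>u < t\<close> the factor \<open>(u / t) ^ n\<close> turns boundedness into convergence to
  0.\<close>

lemma pw_tendsto_0_step:
  assumes x: "x \<in> corner"
    and F: "\<And>n t. n > 0 \<Longrightarrow> (e - pw (scaleC (of_real t) x) n) * F n t = e"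
      "\<And>n t. F n t \<in> corner"
    and M: "\<And>n. norm (F n s) \<le> M"
    and st: "\<And>n. norm (F n t - F n s) \<le> 1/4"
    and lim: "(\<lambda>n. pw (scaleC (of_real s) x) n) \<longlonglongrightarrow> 0"
    and u: "0 \<le> u" "u < t"
  shows "(\<lambda>n. pw (scaleC (of_real u) x) n) \<longlonglongrightarrow> 0"
proof -
  let ?p = "\<lambda>r n. pw (scaleC (of_real r) x) n"
  have F_eq: "F n r - e = ?p r n * F n r" if "n > 0" for n r
    using F(1)[OF that, of r] F(2)[of n r] by (simp add: left_diff_distrib unit_mult algebra_simps)
  have "(\<lambda>n. norm (?p s n) * M) \<longlonglongrightarrow> 0"
    using tendsto_mult_left_zero[OF tendsto_norm_zero[OF lim]] by auto
  then have "\<forall>\<^sub>F n in sequentially. norm (?p s n) * M < 1/4"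
    by (rule order_tendstoD) simp
  then have bd: "\<forall>\<^sub>F n in sequentially. norm (?p t n) \<le> 1"
    using eventually_gt_at_top[of 0]
  proof eventually_elim
    case (elim n)
    have "norm (F n s - e) \<le> norm (?p s n) * norm (F n s)"
      using F_eq[of n s] elim by (simp add: norm_mult_ineq)
    also have "\<dots> \<le> norm (?p s n) * M"
      using M by (intro mult_left_mono) auto
    finally have "norm (F n s - e) \<le> 1/4"
      using elim by simp
    then have le: "norm (F n t - e) \<le> 1/2"
      using st[of n] norm_triangle_ineq[of "F n t - F n s" "F n s - e"] by simp
    have "p = a - c" if "a = b" "c = b - p" for a b c p :: 'a
      using that by simp
    moreover have "?p t n * (F n t - e) = ?p t n * F n t - ?p t n"
      by (simp add: right_diff_distrib)
    ultimately have eq: "(F n t - e) - ?p t n * (F n t - e) = ?p t n"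
      using F_eq[of n t] elim by metis
    have "norm (?p t n) \<le> norm (F n t - e) + norm (?p t n * (F n t - e))"
      using norm_triangle_ineq4[of "F n t - e" "?p t n * (F n t - e)"] by (simp only: eq)
    also have "\<dots> \<le> norm (F n t - e) + norm (?p t n) * norm (F n t - e)"
      by (intro add_left_mono norm_mult_ineq)
    also have "\<dots> \<le> 1/2 + norm (?p t n) * (1/2)"
      using le by (intro add_mono mult_left_mono) auto
    finally show ?case by simp
  qed
  have eq: "norm (?p u n) = (u / t) ^ n * norm (?p t n)" for n
    using u by (simp add: pw_scaleC norm_scaleC norm_power power_divide)
  have "\<forall>\<^sub>F n in sequentially. norm (?p u n) \<le> (u / t) ^ n"
    using bd
  proof eventually_elim
    case (elim n)
    have "(u / t) ^ n * norm (?p t n) \<le> (u / t) ^ n * 1"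
      using elim u by (intro mult_left_mono) auto
    with eq show ?case by simp
  qed
  moreover have "(\<lambda>n. (u / t) ^ n) \<longlonglongrightarrow> 0"
    using u by (intro LIMSEQ_power_zero) simp
  ultimately show ?thesis
    by (rule Lim_null_comparison)
qed

text \<open>The spectral radius formula at radius zero. Averaging the resolvent over the \<open>n\<close>-th roots of
  unity gives the inverse of \<open>e - (t x)\<^sup>n\<close>, and the uniform continuity of the resolvent on discs makes
  these averages equicontinuous in \<open>t\<close>; so the convergence \<open>(t x)\<^sup>n \<rightarrow> 0\<close> propagates from \<open>t = 0\<close>
  by steps of a fixed length.\<close>
lemma pw_tendsto_0_of_resolvent:
  assumes x: "x \<in> corner" and inv: "\<And>c. cinv (e - scaleC c x)" and r: "r \<ge> 0"
  shows "(\<lambda>n. pw (scaleC (of_real r) x) n) \<longlonglongrightarrow> 0"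
proof -
  let ?G = "\<lambda>t. (\<lambda>n. pw (scaleC (of_real t) x) n) \<longlonglongrightarrow> 0"
  obtain f where f: "\<And>c. f c \<in> corner" "\<And>c. (e - scaleC c x) * f c = e"
    using inv unfolding cinv_def by metis
  have cont: "continuous_on (cball 0 (r + 1)) f"
    using resolvent_continuous[OF x f] continuous_on_subset by blast
  then have "bounded (f ` cball 0 (r + 1))"
    by (intro compact_imp_bounded compact_continuous_image) auto
  then obtain M where "\<forall>c\<in>cball 0 (r + 1). norm (f c) \<le> M"
    by (auto simp: bounded_iff)
  then have M: "\<And>c. cmod c \<le> r + 1 \<Longrightarrow> norm (f c) \<le> M"
    by simp
  have "uniformly_continuous_on (cball 0 (r + 1)) f"
    using cont by (intro compact_uniformly_continuous) auto
  then obtain \<delta> where \<delta>: "\<delta> > 0" "\<And>c c'. cmod c \<le> r + 1 \<Longrightarrow> cmod c' \<le> r + 1 \<Longrightarrow>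
      cmod (c' - c) < \<delta> \<Longrightarrow> norm (f c' - f c) < 1/4"
    unfolding uniformly_continuous_on_def dist_norm
    by (metis mem_cball_0 zero_less_divide_1_iff zero_less_numeral)
  define F where "F n t = scaleC (1 / of_nat n) (\<Sum>k<n. f (cis (2 * pi / n) ^ k * of_real t))"
    for n :: nat and t :: real
  have F1: "(e - pw (scaleC (of_real t) x) n) * F n t = e" if "n > 0" for n t
    unfolding F_def using resolvent_average[OF x f that] by simp
  have F2: "F n t \<in> corner" for n t
    by (simp add: F_def f)
  have avg: "norm (scaleC (1 / of_nat n) (\<Sum>k<n. g k)) \<le> K"
    if "\<And>k. norm (g k) \<le> K" "K \<ge> 0" for n K and g :: "nat \<Rightarrow> 'a"
  proof -
    have "norm (\<Sum>k<n. g k) \<le> of_nat n * K"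
      using sum_norm_le[of "{..<n}" g "\<lambda>_. K"] that by simp
    then show ?thesis
      using that by (cases "n = 0") (auto simp: norm_scaleC norm_divide field_simps)
  qed
  have cm: "cmod (cis a ^ k * of_real t) = t" if "t \<ge> 0" for a k t
    using that by (simp add: norm_mult norm_power)
  have M0: "M \<ge> 0"
    using M[of 0] r norm_ge_zero[of "f 0"] by (smt (verit) norm_zero)
  \<comment> \<open>Points up to \<open>s + h\<close> are reached by comparing \<open>s\<close> with
    \<open>s + 2 * h\<close>, which leaves the strict inequality that the step lemma asks for;
    \<open>2 * h \<le> 1\<close> keeps \<open>s + 2 * h\<close> inside the disc of radius
    \<open>r + 1\<close>.\<close>
  define h where "h = min (\<delta> / 4) (1 / 2)"
  have h: "h > 0" "2 * h < \<delta>" "2 * h \<le> 1"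
    using \<delta>(1) by (auto simp: h_def min_def)
  have step: "?G t" if "?G s" "0 \<le> s" "s \<le> r" "s \<le> t" "t \<le> s + h" for s t
  proof (rule pw_tendsto_0_step[OF x, of F s M "s + 2 * h"])
    show "norm (F n s) \<le> M" for n
      unfolding F_def using that M0 r by (intro avg M) (auto simp: cm)
    have "norm (f (cis a ^ k * of_real (s + 2 * h)) - f (cis a ^ k * of_real s)) \<le> 1/4" for a k
    proof -
      have "cis a ^ k * of_real (s + 2 * h) - cis a ^ k * of_real s = cis a ^ k * of_real (2 * h)"
        by (simp add: algebra_simps)
      then have "cmod (cis a ^ k * of_real (s + 2 * h) - cis a ^ k * of_real s) = 2 * h"
        using h by (simp only: cm)
      then show ?thesis
        using that h cm[of s] cm[of "s + 2 * h"]
        by (intro less_imp_le[OF \<delta>(2)]) (simp_all del: of_real_add of_real_mult)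
    qed
    then show "norm (F n (s + 2 * h) - F n s) \<le> 1/4" for n
      unfolding F_def scaleC_diff_right[symmetric] sum_subtractf[symmetric]
      by (intro avg) auto
  qed (use that h F1 F2 in auto)
  have "?G t" if "0 \<le> t" "t \<le> r" "t \<le> real m * h" for m t
    using that
  proof (induction m arbitrary: t)
    case 0
    then have "t = 0" by simp
    \<comment> \<open>The powers of 0 vanish only from exponent 1 on, as
      \<open>pw 0 0 = e\<close>.\<close>
    have "\<forall>\<^sub>F n in sequentially. pw (scaleC (of_real t) x) n = 0"
      using \<open>t = 0\<close>
      by (intro eventually_sequentiallyI[of 1]) (auto simp: pw_Suc Suc_le_eq gr0_conv_Suc)
    then show ?case by (rule tendsto_eventually)
  next
    case (Suc m)
    have "?G (max 0 (t - h))"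
      using Suc.prems h by (intro Suc.IH) (auto simp: algebra_simps max_def)
    then show ?case
      by (rule step) (use Suc.prems h in auto)
  qed
  moreover obtain m where "r \<le> real m * h"
    using h(1) reals_Archimedean3 by (metis less_imp_le)
  ultimately show ?thesis using r by blast
qed

text \<open>In the commutative corner \<open>(y x)^n = y^n x^n\<close>, and the growth of
  \<open>y^n\<close> is beaten by the decay of \<open>(r x)^n\<close>, because \<open>r\<close>
  exceeds \<open>norm y\<close>.\<close>

lemma resolvent_imp_cinv_mult:
  assumes x: "x \<in> corner" and inv: "\<And>c. cinv (e - scaleC c x)" and y: "y \<in> corner"
  shows "cinv (e - y * x)"
proof -
  define r where "r = norm y + 1"
  have "(\<lambda>n. pw (scaleC (of_real r) x) n) \<longlonglongrightarrow> 0"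
    using x inv by (rule pw_tendsto_0_of_resolvent) (simp add: r_def)
  from tendsto_mult_right_zero[OF tendsto_norm_zero[OF this], of "norm e"]
  have "\<forall>\<^sub>F n in sequentially. norm e * norm (pw (scaleC (of_real r) x) n) < 1"
    by (rule order_tendstoD) simp
  then obtain n where n: "norm e * norm (pw (scaleC (of_real r) x) n) < 1"
    by (auto simp: eventually_sequentially)
  have "norm (pw (y * x) n) \<le> norm (pw y n) * norm (pw x n)"
    using x y by (simp add: pw_mult norm_mult_ineq)
  also have "\<dots> \<le> (norm y ^ n * norm e) * norm (pw x n)"
    by (intro mult_right_mono norm_pw_le) auto
  also have "\<dots> \<le> (r ^ n * norm e) * norm (pw x n)"
    by (intro mult_right_mono power_mono) (auto simp: r_def)
  also have "\<dots> = norm e * norm (pw (scaleC (of_real r) x) n)"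
    by (simp add: pw_scaleC norm_scaleC norm_power r_def)
  finally show ?thesis
    using n x y by (intro cinv_unit_minus_pw_small[of _ n]) auto
qed

text \<open>Membership in \<open>jac_rad\<close> tests against the whole algebra. Split
  \<open>a * x = z + r\<close> with \<open>z\<close> in the corner and \<open>r\<close> in
  \<open>rann\<close>. If \<open>w\<close> inverts \<open>e - z\<close>, then
  \<open>y = e - w\<close> is a quasi-inverse of \<open>z\<close>, and the correction
  \<open>y - r * w\<close> is one of \<open>z + r\<close>.\<close>

lemma jac_radI:
  assumes x: "x \<in> corner" and inv: "\<And>y. y \<in> corner \<Longrightarrow> cinv (e - y * x)"
  shows "x \<in> jac_rad"
  unfolding jac_rad_def
proof safe
  fix a
  define z where "z = e * (a * x)"
  obtain w where w: "w \<in> corner" "(e - z) * w = e"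
    using inv[of "e * a"] by (auto simp: z_def mult.assoc cinv_def)
  define y where "y = e - w"
  define r where "r = a * x - z"
  have z: "z \<in> corner" by (simp add: z_def)
  have y: "y \<in> corner" using w by (simp add: y_def)
  have ann: "b * r = 0" for b
    by (simp add: r_def z_def right_diff_distrib mult.assoc[symmetric])
  have zy: "z + y = z * y"
    using w z by (simp add: y_def algebra_simps unit_mult)
  have yz: "y * z = z * y" using y z by (rule corner_comm)
  have wz: "w * z = w - e"
    using w z corner_comm[of w z] by (simp add: algebra_simps unit_mult)
  have ry: "r * y = r - r * w" by (simp add: y_def right_diff_distrib)
  have ax: "a * x = z + r" by (simp add: r_def)
  have "r * (w * z) = r * w - r" by (simp add: wz right_diff_distrib)
  moreover have "b * (r * c) = 0" for b c
    by (simp add: ann mult.assoc[symmetric])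
  ultimately have "(z + r) + (y - r * w) - (z + r) * (y - r * w) = 0"
    "(z + r) + (y - r * w) - (y - r * w) * (z + r) = 0"
    using zy yz ann by (simp_all add: distrib_left distrib_right left_diff_distrib
        right_diff_distrib mult.assoc ry)
  then show "quasi_invertible (a * x)"
    unfolding quasi_invertible_def ax by blast
qed

end

section \<open>The closed graph theorem\<close>

text \<open>By Baire, the closure of some sublevel set of \<open>norm (f x)\<close> contains a ball.
  Differences and scaling then approximate every \<open>v\<close> arbitrarily well by some
  \<open>y\<close> with \<open>norm (f y) \<le> C * norm v\<close>; successive approximation, with
  closedness to pass to the limit, bounds \<open>f\<close> itself.\<close>

lemma closed_graph_bounded_linear:
  fixes f :: "'a::banach \<Rightarrow> 'b::banach"
  assumes lin: "linear f"
    and closed: "\<And>x y. x \<longlonglongrightarrow> 0 \<Longrightarrow> (\<lambda>n. f (x n)) \<longlonglongrightarrow> y \<Longrightarrow> y = 0"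
  shows "bounded_linear f"
proof -
  interpret linear f by fact
  define U where "U n = closure {x. norm (f x) \<le> real n}" for n :: nat
  have "\<exists>n. interior (U n) \<noteq> {}"
  proof (rule ccontr)
    assume "\<not> ?thesis"
    then have "closedin euclidean (U n) \<and> euclidean interior_of U n = {}" for n
      by (simp add: U_def)
    then have "euclidean interior_of (\<Union>(range U)) = {}"
      by (intro Baire_category_alt disjI1 completely_metrizable_space_euclidean) auto
    moreover have "\<Union>(range U) = UNIV"
    proof (intro set_eqI iffI)
      fix x
      obtain n where "norm (f x) \<le> real n" using real_arch_simple by blast
      then have "x \<in> U n" unfolding U_def by (intro subsetD[OF closure_subset]) simp
      then show "x \<in> \<Union>(range U)" by blast
    qed simp
    ultimately show False by simp
  qed
  then obtain n x0 \<epsilon> where \<epsilon>: "\<epsilon> > 0" "ball x0 \<epsilon> \<subseteq> U n"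
    using mem_interior by blast
  \<comment> \<open>\<open>2 * real n\<close> bounds \<open>f\<close> on differences of two points
    of the sublevel set; \<open>2 / \<epsilon>\<close> comes from rescaling \<open>v\<close> to norm
    \<open>\<epsilon> / 2\<close>.\<close>
  define C where "C = 2 * real n * (2 / \<epsilon>)"
  have C: "C \<ge> 0" using \<epsilon> by (simp add: C_def)
  have near: "\<exists>y. norm (v - y) < \<eta> \<and> norm (f y) \<le> 2 * real n" if "norm v < \<epsilon>" "\<eta> > 0" for v \<eta>
  proof -
    have "x0 + v \<in> U n" "x0 \<in> U n"
      using \<epsilon> that by (auto simp: subset_iff dist_norm)
    then obtain y1 y2 where y: "norm (f y1) \<le> n" "norm (y1 - (x0 + v)) < \<eta> / 2"
        "norm (f y2) \<le> n" "norm (y2 - x0) < \<eta> / 2"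
      unfolding U_def closure_approachable dist_norm using \<open>\<eta> > 0\<close>
      by (metis (mono_tags, lifting) half_gt_zero mem_Collect_eq)
    have "(y2 - x0) - (y1 - (x0 + v)) = v - (y1 - y2)"
      by simp
    then have "norm (v - (y1 - y2)) < \<eta>"
      using y norm_triangle_ineq4[of "y2 - x0" "y1 - (x0 + v)"] by (simp only:)
    moreover have "norm (f (y1 - y2)) \<le> 2 * real n"
      using y norm_triangle_ineq4[of "f y1" "f y2"] by (simp add: diff)
    ultimately show ?thesis by blast
  qed
  have "\<exists>y. norm (v - y) < \<eta> \<and> norm (f y) \<le> C * norm v" if "\<eta> > 0" for v \<eta>
  proof (cases "v = 0")
    case True
    with that show ?thesis by (intro exI[of _ 0]) (simp add: zero)
  next
    case False
    define t where "t = \<epsilon> / (2 * norm v)"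
    have t: "t > 0" using False \<epsilon> by (simp add: t_def)
    have "norm (t *\<^sub>R v) < \<epsilon>"
      using False \<epsilon> t by (simp add: t_def)
    then obtain y where y: "norm (t *\<^sub>R v - y) < t * \<eta>" "norm (f y) \<le> 2 * real n"
      using near[of "t *\<^sub>R v" "t * \<eta>"] \<open>\<eta> > 0\<close> t by auto
    have "v - (1 / t) *\<^sub>R y = (1 / t) *\<^sub>R (t *\<^sub>R v - y)"
      using t by (simp add: scaleR_diff_right)
    then have "norm (v - (1 / t) *\<^sub>R y) = norm (t *\<^sub>R v - y) / t"
      using t by (simp only: norm_scaleR) simp
    then have "norm (v - (1 / t) *\<^sub>R y) < \<eta>"
      using y t by (simp add: divide_less_eq mult.commute)
    moreover have "norm (f ((1 / t) *\<^sub>R y)) \<le> C * norm v"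
    proof -
      have "norm (f ((1 / t) *\<^sub>R y)) = 1 / t * norm (f y)"
        using t by (simp add: scale)
      also have "\<dots> \<le> 1 / t * (2 * real n)"
        using t y by (intro mult_left_mono) auto
      also have "\<dots> = C * norm v"
        using False \<epsilon> by (simp add: t_def C_def field_simps)
      finally show ?thesis .
    qed
    ultimately show ?thesis by blast
  qed
  then have "\<forall>v \<eta>. \<exists>y. \<eta> > 0 \<longrightarrow> norm (v - y) < \<eta> \<and> norm (f y) \<le> C * norm v"
    by blast
  then obtain g where "\<forall>v \<eta>. \<eta> > 0 \<longrightarrow> norm (v - g v \<eta>) < \<eta> \<and> norm (f (g v \<eta>)) \<le> C * norm v"
    unfolding choice_iff by blast
  then have g: "norm (v - g v \<eta>) < \<eta>" "norm (f (g v \<eta>)) \<le> C * norm v" if "\<eta> > 0" for v \<eta>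
    using that by blast+
  have "norm (f x) \<le> norm x * (2 * C)" for x
  proof (cases "x = 0")
    case False
    define \<eta> where "\<eta> k = norm x * (1 / 2) ^ k" for k :: nat
    have \<eta>: "\<eta> k > 0" for k using False by (simp add: \<eta>_def)
    \<comment> \<open>\<open>r k\<close> is the error left after \<open>k\<close> approximations;
      its norm is at most \<open>norm x / 2 ^ k\<close>.\<close>
    define r where "r = rec_nat x (\<lambda>k v. v - g v (\<eta> (Suc k)))"
    have r0: "r 0 = x" and rS: "r (Suc k) = r k - g (r k) (\<eta> (Suc k))" for k
      by (simp_all add: r_def)
    have r: "norm (r k) \<le> \<eta> k" for k
      using g(1)[OF \<eta>, of _ "k"] by (cases k) (auto simp: r0 rS \<eta>_def less_imp_le)
    define h where "h k = f (g (r k) (\<eta> (Suc k)))" for k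
    have h: "norm (h k) \<le> C * norm x * (1 / 2) ^ k" for k
      using g(2)[OF \<eta>, of "r k" "Suc k"] mult_left_mono[OF r[of k] C]
      by (simp add: h_def \<eta>_def mult.assoc)
    have hs: "summable (\<lambda>k. C * norm x * (1 / 2) ^ k)"
      by (intro summable_mult summable_geometric) simp
    have sm: "summable h"
      using hs h by (rule summable_comparison_test')
    have "norm (suminf h) \<le> (\<Sum>k. C * norm x * (1 / 2) ^ k)"
      using h hs by (rule norm_suminf_le)
    also have "\<dots> = C * norm x * 2"
      by (subst suminf_mult) (auto simp: suminf_geometric)
    finally have le: "norm (suminf h) \<le> norm x * (2 * C)"
      by (simp add: mult_ac)
    have fr: "f (r k) = f x - (\<Sum>j<k. h j)" for k
      by (induction k) (auto simp: r0 rS h_def diff)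
    have "(\<lambda>k. f (r k)) \<longlonglongrightarrow> f x - suminf h"
      unfolding fr by (intro tendsto_intros summable_LIMSEQ sm)
    moreover have "r \<longlonglongrightarrow> 0"
    proof (rule Lim_null_comparison)
      show "\<forall>\<^sub>F k in sequentially. norm (r k) \<le> \<eta> k" using r by simp
      show "\<eta> \<longlonglongrightarrow> 0"
        unfolding \<eta>_def by (intro tendsto_mult_right_zero LIMSEQ_power_zero) simp
    qed
    ultimately have "f x - suminf h = 0" by (intro closed)
    then show ?thesis using le by simp
  qed (simp add: zero)
  then show ?thesis
    by (intro bounded_linear_intro[of f "2 * C"] add scale) auto
qed

section \<open>Polynomials with simple roots\<close>

lemma poly_prod_linear_factors:
  fixes A :: "complex set"
  assumes "finite A"
  shows "poly (\<Prod>a\<in>A. [:-a, 1:]) r = 0 \<longleftrightarrow> r \<in> A"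
  using assms by (simp add: poly_prod)

text \<open>In the product rule exactly one of the two summands is nonzero at a root:
  \<open>poly ?q r\<close> if \<open>r = a\<close>, the other one if \<open>r\<close> lies in
  \<open>A\<close>.\<close>

lemma pderiv_prod_linear_factors:
  fixes A :: "complex set"
  assumes "finite A" "r \<in> A"
  shows "poly (pderiv (\<Prod>a\<in>A. [:-a, 1:])) r \<noteq> 0"
  using assms
proof (induction A)
  case (insert a A)
  let ?q = "\<Prod>a\<in>A. [:-a, 1:]"
  have "pderiv [:-a, 1:] = 1" by (simp add: pderiv_pCons one_pCons)
  then have "pderiv ([:-a, 1:] * ?q) = [:-a, 1:] * pderiv ?q + ?q"
    by (simp only: pderiv_mult mult_1_right)
  moreover have "(\<Prod>a\<in>insert a A. [:-a, 1:]) = [:-a, 1:] * ?q"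
    using insert by (intro prod.insert)
  ultimately have "poly (pderiv (\<Prod>a\<in>insert a A. [:-a, 1:])) r = (r - a) * poly (pderiv ?q) r + poly ?q r"
    by (simp only: poly_add poly_mult) simp
  then show ?case
    using insert poly_prod_linear_factors[of A r] by auto
qed simp

context right_unital_algebra
begin

section \<open>Quotient seminorms and the spectrum\<close>

text \<open>The seminorm of the residue class of \<open>y\<close> modulo the right ideal
  \<open>a A\<close>, without forming a quotient type.\<close>

definition quot_norm :: "'a \<Rightarrow> 'a \<Rightarrow> real" where
  "quot_norm a y = infdist y (range ((*) a))"

lemma quot_norm_le: "quot_norm a y \<le> norm y"
  using infdist_le[of 0 "range ((*) a)" y] rangeI[of "(*) a" 0] by (simp add: quot_norm_def)

lemma quot_norm_add_multiple: "quot_norm a (y + a * b) \<le> quot_norm a y"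
proof -
  have "quot_norm a (y + a * b) \<le> norm (y - a * c)" for c
    using infdist_le[OF rangeI[of "(*) a" "b + c"], of "y + a * b"]
    by (simp add: quot_norm_def dist_norm distrib_left)
  then show ?thesis
    unfolding quot_norm_def[of a y] infdist_def by (auto simp: dist_norm intro!: cINF_greatest)
qed

text \<open>A proper ideal has distance at least 1 from the unit, since corner elements closer to
  \<open>e\<close> are invertible.\<close>

lemma quot_norm_unit:
  assumes a: "a \<in> corner" "\<not> cinv a"
  shows "quot_norm a (scaleC c e) \<ge> cmod c"
proof -
  have "norm (scaleC c e - a * b) \<ge> cmod c" for b
  proof (cases "c = 0")
    case False
    show ?thesis
    proof (rule ccontr)
      assume *: "\<not> ?thesis"
      \<comment> \<open>Replacing \<open>b\<close> by \<open>e * b\<close> does not change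
        \<open>a * b\<close> and moves the cofactor into the corner.\<close>
      have "scaleC c e - a * b = scaleC c (e - a * (scaleC (1 / c) (e * b)))"
        using False by (simp add: scaleC_diff_right mult_scaleC_right scaleC_scaleC scaleC_one
            mult.assoc[symmetric])
      with * have "norm (e - a * (scaleC (1 / c) (e * b))) < 1"
        using False by (simp add: norm_scaleC)
      then have "cinv (e - (e - a * (scaleC (1 / c) (e * b))))"
        using a by (intro cinv_unit_minus_small) auto
      then have "cinv (a * (scaleC (1 / c) (e * b)))" by simp
      then have "cinv a" by (rule cinv_factor[rotated]) simp
      with a show False by simp
    qed
  qed simp
  then show ?thesis
    unfolding quot_norm_def infdist_def by (auto simp: dist_norm intro!: cINF_greatest)
qed

text \<open>Modulo \<open>s - scaleC \<mu> e\<close>, the element \<open>ev p s\<close> is congruent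
  to \<open>scaleC (poly p \<mu>) e\<close>.\<close>

lemma quot_norm_ev:
  assumes s: "s \<in> corner" "\<not> cinv (s - scaleC \<mu> e)"
  shows "quot_norm (s - scaleC \<mu> e) (ev p s) \<ge> cmod (poly p \<mu>)"
proof -
  have "[:-\<mu>, 1:] dvd p - [:poly p \<mu>:]"
    by (subst poly_eq_0_iff_dvd[symmetric]) simp
  then obtain h where h: "p - [:poly p \<mu>:] = [:-\<mu>, 1:] * h" ..
  have "ev [:-\<mu>, 1:] s = s - scaleC \<mu> e"
    by (simp add: scaleC_minus_left scaleC_one)
  then have "ev p s - scaleC (poly p \<mu>) e = (s - scaleC \<mu> e) * ev h s"
    using arg_cong[OF h, of "\<lambda>p. ev p s"] by (simp only: ev_diff ev_mult[OF s(1)]) simp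
  then have "scaleC (poly p \<mu>) e = ev p s + (s - scaleC \<mu> e) * (- ev h s)"
    by (simp add: algebra_simps)
  then show ?thesis
    using quot_norm_add_multiple[of "s - scaleC \<mu> e" "ev p s" "- ev h s"]
      quot_norm_unit[of "s - scaleC \<mu> e" "poly p \<mu>"] s by simp
qed

lemma spectrum_bounded:
  assumes s: "s \<in> corner" "\<not> cinv (s - scaleC \<mu> e)"
  shows "cmod \<mu> \<le> norm s"
proof (rule ccontr)
  assume *: "\<not> ?thesis"
  then have nz: "\<mu> \<noteq> 0" by auto
  have "norm (scaleC (1 / \<mu>) s) < 1"
    using * nz by (simp add: norm_scaleC norm_divide field_simps)
  then have "cinv (scaleC (- \<mu>) (e - scaleC (1 / \<mu>) s))"
    using s nz by (intro cinv_scaleC cinv_unit_minus_small) auto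
  moreover have "scaleC (- \<mu>) (e - scaleC (1 / \<mu>) s) = s - scaleC \<mu> e"
    using nz by (simp add: scaleC_diff_right scaleC_scaleC scaleC_minus_left scaleC_one)
  ultimately show False using s by simp
qed

end

section \<open>The separating space of a derivation of the corner\<close>

text \<open>\<open>D\<close> is a derivation of the corner, extended to the whole type through the
  projection \<open>x \<mapsto> e * x\<close>; the closed graph theorem, which is stated for types,
  thus applies to it.\<close>

locale semisimple_derivation = right_unital_algebra e
  for e :: "'a::complex_banach_algebra" +
  fixes D :: "'a \<Rightarrow> 'a"
  assumes semisimple: "x \<in> corner \<Longrightarrow> x \<in> jac_rad \<Longrightarrow> x = 0"
    and D_corner [simp]: "D x \<in> corner"
    and D_add: "D (x + y) = D x + D y"
    and D_scaleC: "D (scaleC c x) = scaleC c (D x)"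
    and D_mult: "x \<in> corner \<Longrightarrow> y \<in> corner \<Longrightarrow> D (x * y) = D x * y + x * D y"
    and D_unit_mult: "D (e * x) = D x"
begin

text \<open>Quasinilpotent elements of the corner lie in the radical, hence vanish.\<close>

lemma zero_if_resolvent: "x \<in> corner \<Longrightarrow> (\<And>c. cinv (e - scaleC c x)) \<Longrightarrow> x = 0"
  by (intro semisimple jac_radI resolvent_imp_cinv_mult)

lemma D_scaleR: "D (scaleR c x) = scaleR c (D x)"
  by (simp add: scaleR_scaleC D_scaleC)

lemma D_zero [simp]: "D 0 = 0"
  using D_scaleR[of 0 0] by simp

lemma D_diff: "D (x - y) = D x - D y"
  using D_add[of "x - y" y] by simp

lemma D_unit [simp]: "D e = 0"
  using D_mult[of e e] by (simp add: unit_mult)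

lemma D_ev: "x \<in> corner \<Longrightarrow> D (ev p x) = ev (pderiv p) x * D x"
proof (induction p)
  case (pCons a p)
  then show ?case
    using corner_comm[of "D x" "ev p x"]
    by (simp add: D_add D_scaleC D_mult pderiv_pCons ev_add distrib_right mult.assoc)
qed simp

text \<open>The separating space measures how far the graph of \<open>D\<close> is from being
  closed.\<close>

definition separating :: "'a set" where
  "separating = {s. \<exists>f. (\<forall>n. f n \<in> corner) \<and> f \<longlonglongrightarrow> 0 \<and> (\<lambda>n. D (f n)) \<longlonglongrightarrow> s}"

lemma separating_corner: "s \<in> separating \<Longrightarrow> s \<in> corner"
  unfolding separating_def using corner_limit D_corner by blast

lemma separating_mult:
  assumes "s \<in> separating" "a \<in> corner"
  shows "s * a \<in> separating"
proof -
  obtain f where f: "\<And>n. f n \<in> corner" "f \<longlonglongrightarrow> 0" "(\<lambda>n. D (f n)) \<longlonglongrightarrow> s"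
    using assms by (auto simp: separating_def)
  have "(\<lambda>n. D (f n) * a + f n * D a) \<longlonglongrightarrow> s * a + 0 * D a"
    using f by (intro tendsto_intros)
  then have "(\<lambda>n. D (f n * a)) \<longlonglongrightarrow> s * a"
    using f assms by (simp add: D_mult)
  moreover have "(\<lambda>n. f n * a) \<longlonglongrightarrow> 0"
    using f by (intro tendsto_mult_left_zero)
  ultimately show ?thesis
    using f unfolding separating_def by (auto intro!: exI[of _ "\<lambda>n. f n * a"])
qed

text \<open>If \<open>f\<close> is a null sequence with \<open>D (f n)\<close> tending to
  \<open>s\<close>, then \<open>D (ev p s * (\<tau> *\<^sub>R f n))\<close> tends to
  \<open>\<tau>\<close> times \<open>ev p s * s\<close>, whose class modulo
  \<open>s - scaleC \<mu> e\<close> is the scalar \<open>\<tau> * poly p \<mu> * \<mu>\<close>. A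
  large \<open>\<tau>\<close> makes this exceed \<open>N\<close>, while the scaled sequence still
  tends to 0.\<close>

lemma separating_hump:
  assumes s: "s \<in> separating" "\<not> cinv (s - scaleC \<mu> e)" and nz: "\<mu> \<noteq> 0" "poly p \<mu> \<noteq> 0"
    and "\<eta> > 0"
  shows "\<exists>x\<in>corner. norm x < \<eta> \<and> quot_norm (s - scaleC \<mu> e) (D (ev p s * x)) > N"
proof -
  obtain f where f: "\<And>n. f n \<in> corner" "f \<longlonglongrightarrow> 0" "(\<lambda>n. D (f n)) \<longlonglongrightarrow> s"
    using s by (auto simp: separating_def)
  have sc: "s \<in> corner" using s by (simp add: separating_corner)
  define \<tau> where "\<tau> = (\<bar>N\<bar> + 1) / cmod (poly p \<mu> * \<mu>)"
  have \<tau>: "\<tau> * cmod (poly p \<mu> * \<mu>) > N" "\<tau> > 0"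
    using nz by (auto simp: \<tau>_def)
  let ?P = "ev p s"
  have "(\<lambda>n. D ?P * (\<tau> *\<^sub>R f n) + ?P * (\<tau> *\<^sub>R D (f n))) \<longlonglongrightarrow>
      D ?P * (\<tau> *\<^sub>R 0) + ?P * (\<tau> *\<^sub>R s)"
    using f by (intro tendsto_intros)
  then have "(\<lambda>n. D (?P * (\<tau> *\<^sub>R f n))) \<longlonglongrightarrow> ?P * (\<tau> *\<^sub>R s)"
    using f sc by (simp add: D_mult D_scaleR scaleR_add_right)
  moreover have "?P * (\<tau> *\<^sub>R s) = ev (smult (of_real \<tau>) (p * [:0, 1:])) s"
    by (simp only: ev_smult ev_mult[OF sc] ev_X scaleR_scaleC mult_scaleC_right)
  ultimately have "(\<lambda>n. quot_norm (s - scaleC \<mu> e) (D (?P * (\<tau> *\<^sub>R f n)))) \<longlonglongrightarrow>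
      quot_norm (s - scaleC \<mu> e) (ev (smult (of_real \<tau>) (p * [:0, 1:])) s)"
    unfolding quot_norm_def by (intro tendsto_infdist) simp
  moreover have "N < quot_norm (s - scaleC \<mu> e) (ev (smult (of_real \<tau>) (p * [:0, 1:])) s)"
    using quot_norm_ev[OF sc s(2), of "smult (of_real \<tau>) (p * [:0, 1:])"] \<tau>
    by (simp add: norm_mult mult_ac)
  ultimately have "\<forall>\<^sub>F n in sequentially. N < quot_norm (s - scaleC \<mu> e) (D (?P * (\<tau> *\<^sub>R f n)))"
    by (rule order_tendstoD)
  moreover have "(\<lambda>n. norm (\<tau> *\<^sub>R f n)) \<longlonglongrightarrow> norm (\<tau> *\<^sub>R (0::'a))"
    using f by (intro tendsto_intros)
  then have "\<forall>\<^sub>F n in sequentially. norm (\<tau> *\<^sub>R f n) < \<eta>"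
    by (rule order_tendstoD) (use \<open>\<eta> > 0\<close> in simp)
  ultimately have "\<forall>\<^sub>F n in sequentially. norm (\<tau> *\<^sub>R f n) < \<eta> \<and>
      N < quot_norm (s - scaleC \<mu> e) (D (?P * (\<tau> *\<^sub>R f n)))"
    by eventually_elim simp
  then obtain n where "norm (\<tau> *\<^sub>R f n) < \<eta> \<and>
      N < quot_norm (s - scaleC \<mu> e) (D (?P * (\<tau> *\<^sub>R f n)))"
    by (auto simp: eventually_sequentially)
  then show ?thesis
    using f(1) by (intro bexI[of _ "\<tau> *\<^sub>R f n"]) auto
qed

text \<open>A gliding hump argument: the humps \<open>x n\<close> are so small that \<open>Z = \<Sum>n. P n * x n\<close> converges,
  where \<open>P n\<close> is the product of the first \<open>n\<close> elements \<open>s - \<mu> i\<close>. Modulo \<open>s - \<mu> n\<close> the tail of the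
  series is harmless, as \<open>D\<close> maps multiples of \<open>P (Suc n)\<close> continuously to the quotient; so \<open>D Z\<close>
  would have quotient norm at least \<open>n\<close> for every \<open>n\<close>.\<close>
lemma separating_finite_spectrum:
  assumes s: "s \<in> separating"
  shows "finite {\<mu>. \<mu> \<noteq> 0 \<and> \<not> cinv (s - scaleC \<mu> e)}" (is "finite ?\<Lambda>")
proof (rule ccontr)
  assume "infinite ?\<Lambda>"
  then obtain \<mu> :: "nat \<Rightarrow> complex" where inj: "inj \<mu>" and "range \<mu> \<subseteq> ?\<Lambda>"
    using infinite_countable_subset by blast
  then have \<mu>: "\<mu> n \<noteq> 0" "\<not> cinv (s - scaleC (\<mu> n) e)" for n
    by auto
  have sc: "s \<in> corner" using s by (rule separating_corner)
  define a where "a n = s - scaleC (\<mu> n) e" for n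
  have ac: "a n \<in> corner" for n using sc by (simp add: a_def)
  \<comment> \<open>The spectrum is bounded by \<open>norm s\<close>, so one constant
    \<open>K\<close> dominates all \<open>a n\<close>; humps smaller than
    \<open>(1 / (2 * K)) ^ n\<close> then outweigh the growth of the products.\<close>
  define K where "K = 1 + norm s + norm s * norm e"
  have K: "K \<ge> 1" by (simp add: K_def)
  have aK: "norm (a n) \<le> K" for n
  proof -
    have "norm (a n) \<le> norm s + cmod (\<mu> n) * norm e"
      unfolding a_def norm_scaleC[symmetric] by (rule norm_triangle_ineq4)
    also have "\<dots> \<le> norm s + norm s * norm e"
      using spectrum_bounded[OF sc \<mu>(2)] by (intro add_left_mono mult_right_mono) auto
    finally show ?thesis by (simp add: K_def)
  qed
  \<comment> \<open>The product over the block of indices from \<open>m\<close> to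
    \<open>m + n - 1\<close>, so that \<open>P m\<close> can be split off from the later terms of
    the series.\<close>
  define p where "p m n = (\<Prod>i<n. [:- \<mu> (m + i), 1:])" for m n :: nat
  define R where "R m n = ev (p m n) s" for m n
  define P where "P = R 0"
  have Rc: "R m n \<in> corner" for m n using sc by (simp add: R_def)
  have RS: "R m (Suc n) = R m n * a (m + n)" for m n
  proof -
    have "ev [:- \<mu> (m + n), 1:] s = a (m + n)"
      by (simp add: a_def scaleC_minus_left scaleC_one)
    then show ?thesis
      unfolding R_def p_def prod.lessThan_Suc by (simp only: ev_mult[OF sc])
  qed
  have R0: "R m 0 = e" for m by (simp add: R_def p_def)
  have RP: "P (m + n) = P m * R m n" for m n
    by (induction n) (simp_all add: P_def R0 RS mult.assoc)
  have Rn: "norm (R m n) \<le> norm e * K ^ n" for m n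
  proof (induction n)
    case (Suc n)
    have "norm (R m (Suc n)) \<le> norm (R m n) * norm (a (m + n))"
      by (simp add: RS norm_mult_ineq)
    also have "\<dots> \<le> (norm e * K ^ n) * K"
      using K by (intro mult_mono Suc aK) auto
    finally show ?case by (simp add: mult_ac)
  qed (simp add: R0)
  have pnz: "poly (p 0 n) (\<mu> n) \<noteq> 0" for n
    using inj by (auto simp: p_def poly_prod dest: injD)
  \<comment> \<open>The extra summands pay for \<open>D\<close> of the partial sum \<open>z\<close>
    and for the tail, whose cofactor \<open>u (Suc n)\<close> has norm at most
    \<open>2 * norm e\<close>.\<close>
  have "\<exists>x. x \<in> corner \<and> norm x < (1 / (2 * K)) ^ n \<and>
      quot_norm (a n) (D (P n * x)) > real n + norm (D z) + norm (D (P (Suc n))) * (2 * norm e)"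
    for n z
    using separating_hump[OF s \<mu>(2) \<mu>(1) pnz, of "(1 / (2 * K)) ^ n"] K
    by (fastforce simp: a_def P_def R_def)
  then obtain g where g: "\<And>n z. g n z \<in> corner" "\<And>n z. norm (g n z) < (1 / (2 * K)) ^ n"
      "\<And>n z. quot_norm (a n) (D (P n * g n z)) >
        real n + norm (D z) + norm (D (P (Suc n))) * (2 * norm e)"
    by metis
  \<comment> \<open>The partial sums come first, by recursion, since the choice of each hump depends
    on the sum before it.\<close>
  define z where "z = rec_nat 0 (\<lambda>n z. z + P n * g n z)"
  define x where "x n = g n (z n)" for n
  have z: "z n = (\<Sum>j<n. P j * x j)" for n
    by (induction n) (simp_all add: z_def x_def)
  have term_le: "norm (R m j * x (m + j)) \<le> norm e * (1 / 2) ^ j" for m j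
  proof -
    have "norm (x (m + j)) \<le> (1 / (2 * K)) ^ (m + j)"
      using g(2) by (simp add: x_def less_imp_le)
    also have "\<dots> \<le> (1 / (2 * K)) ^ j"
      using K by (intro power_decreasing) auto
    finally have "norm (R m j) * norm (x (m + j)) \<le> (norm e * K ^ j) * (1 / (2 * K)) ^ j"
      using K by (intro mult_mono Rn) auto
    also have "\<dots> = norm e * (1 / 2) ^ j"
      using K by (simp add: power_divide power_mult_distrib)
    finally show ?thesis
      using norm_mult_ineq order_trans by blast
  qed
  have gs: "summable (\<lambda>j. norm e * (1 / 2 :: real) ^ j)"
    by (intro summable_mult summable_geometric) simp
  have sm: "summable (\<lambda>j. R m j * x (m + j))" for m
    using gs term_le by (rule summable_comparison_test')
  define u where "u m = (\<Sum>j. R m j * x (m + j))" for m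
  have un: "norm (u m) \<le> 2 * norm e" for m
  proof -
    have "norm (u m) \<le> (\<Sum>j. norm e * (1 / 2) ^ j)"
      unfolding u_def using term_le gs by (rule norm_suminf_le)
    also have "\<dots> = 2 * norm e"
      by (subst suminf_mult) (auto simp: suminf_geometric)
    finally show ?thesis .
  qed
  have uc: "u m \<in> corner" for m
    using summable_LIMSEQ[OF sm] unfolding u_def
    by (rule corner_limit) (auto intro!: corner_mult corner_sum Rc)
  have split: "u 0 = P (Suc n) * u (Suc n) + z (Suc n)" for n
  proof -
    have "u 0 = (\<Sum>j. P (j + Suc n) * x (j + Suc n)) + z (Suc n)"
      using suminf_split_initial_segment[OF sm[of 0], of "Suc n"] by (simp add: u_def z P_def)
    also have "(\<lambda>j. P (j + Suc n) * x (j + Suc n)) = (\<lambda>j. P (Suc n) * (R (Suc n) j * x (Suc n + j)))"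
      using RP[of "Suc n"] by (simp add: add.commute mult.assoc)
    finally show ?thesis
      unfolding u_def by (simp only: suminf_mult[OF sm])
  qed
  have "real n < norm (D (u 0))" for n
  proof -
    have Pc: "P k \<in> corner" for k by (simp add: P_def Rc)
    \<comment> \<open>With the factor \<open>a n\<close> in front, the summand
      \<open>P (Suc n) * D (u (Suc n))\<close> vanishes in the quotient.\<close>
    have "P (Suc n) = a n * P n"
      using RS[of 0 n] corner_comm[OF Pc ac] by (simp add: P_def)
    then have "D (P (Suc n) * u (Suc n)) =
        D (P (Suc n)) * u (Suc n) + a n * (P n * D (u (Suc n)))"
      using D_mult[OF Pc[of "Suc n"] uc] by (metis mult.assoc)
    moreover have "D (u 0) = D (P (Suc n) * u (Suc n)) + (D (z n) + D (P n * x n))"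
      by (simp add: split[of n] D_add z)
    ultimately have "D (P n * x n) =
        (D (u 0) - D (z n) - D (P (Suc n)) * u (Suc n)) + a n * (- (P n * D (u (Suc n))))"
      by (simp add: algebra_simps)
    then have "quot_norm (a n) (D (P n * x n)) \<le> norm (D (u 0) - D (z n) - D (P (Suc n)) * u (Suc n))"
      using quot_norm_add_multiple quot_norm_le order_trans by metis
    also have "\<dots> \<le> norm (D (u 0)) + norm (D (z n)) + norm (D (P (Suc n))) * norm (u (Suc n))"
      by (intro order_trans[OF norm_triangle_ineq4] add_mono norm_triangle_ineq4 norm_mult_ineq)
    also have "\<dots> \<le> norm (D (u 0)) + norm (D (z n)) + norm (D (P (Suc n))) * (2 * norm e)"
      using un by (intro add_left_mono mult_left_mono) auto
    finally show ?thesis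
      using g(3)[of n "z n"] by (simp add: x_def)
  qed
  then show False
    using reals_Archimedean2[of "norm (D (u 0))"] less_asym by blast
qed

text \<open>By finiteness of the spectrum, \<open>s\<close> is a root of a polynomial \<open>q\<close> with simple roots, and then
  \<open>0 = D (q s) = q' s * D s\<close> with \<open>q' s\<close> invertible.\<close>
lemma D_separating:
  assumes s: "s \<in> separating"
  shows "D s = 0"
proof -
  have sc: "s \<in> corner" using s by (rule separating_corner)
  \<comment> \<open>Zero is included whether or not it lies in the spectrum, so that
    \<open>A\<close> covers the spectrum and \<open>poly q 0 = 0\<close>.\<close>
  define A where "A = insert 0 {\<mu>. \<mu> \<noteq> 0 \<and> \<not> cinv (s - scaleC \<mu> e)}"
  have fin: "finite A" using separating_finite_spectrum[OF s] by (simp add: A_def)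
  define q where "q = (\<Prod>a\<in>A. [:-a, 1:])"
  have q: "poly q r = 0 \<longleftrightarrow> r \<in> A" for r
    unfolding q_def by (rule poly_prod_linear_factors[OF fin])
  have cinv: "cinv (s - scaleC r e)" if "poly q r \<noteq> 0" for r
    using that q[of r] by (auto simp: A_def)
  have "ev q s = 0"
  proof (rule zero_if_resolvent)
    fix c
    \<comment> \<open>\<open>1 - smult c q\<close> has value 1 on \<open>A\<close>; hence it is
      nonzero, its roots avoid the spectrum of \<open>s\<close>, and its value at \<open>s\<close>
      is invertible.\<close>
    have 1: "poly (1 - smult c q) r = 1" if "poly q r = 0" for r
      using that by simp
    have "poly q 0 = 0"
      using q by (simp add: A_def)
    then have "1 - smult c q \<noteq> 0"
      using 1[of 0] by (metis poly_0 zero_neq_one)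
    moreover have "poly q r \<noteq> 0" if "poly (1 - smult c q) r = 0" for r
      using 1[of r] that by auto
    ultimately have "cinv (ev (1 - smult c q) s)"
      by (intro cinv_ev[OF sc] cinv) auto
    then show "cinv (e - scaleC c (ev q s))"
      by (simp add: ev_diff ev_smult)
  qed (simp add: sc)
  then have 0: "ev (pderiv q) s * D s = 0"
    using D_ev[OF sc, of q] by simp
  have "poly (pderiv q) 0 \<noteq> 0"
    unfolding q_def by (rule pderiv_prod_linear_factors[OF fin]) (simp add: A_def)
  then have "cinv (ev (pderiv q) s)"
    using pderiv_prod_linear_factors[OF fin, folded q_def] q
    by (intro cinv_ev[OF sc] cinv) auto
  then obtain w where w: "w \<in> corner" "ev (pderiv q) s * w = e"
    by (auto simp: cinv_def)
  then have "w * ev (pderiv q) s = e"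
    using sc by (simp add: corner_comm)
  then show ?thesis
    using 0 unit_mult[OF D_corner] by (metis mult.assoc mult_zero_right)
qed

text \<open>\<open>D\<close> kills both \<open>s\<close> and \<open>s * f n\<close>, so the product
  rule leaves \<open>s * D (f n) = 0\<close>; in the limit \<open>s * s = 0\<close>, and nilpotent
  elements are quasinilpotent.\<close>

lemma separating_zero:
  assumes s: "s \<in> separating"
  shows "s = 0"
proof -
  have sc: "s \<in> corner" using s by (rule separating_corner)
  obtain f where f: "\<And>n. f n \<in> corner" "(\<lambda>n. D (f n)) \<longlonglongrightarrow> s"
    using s by (auto simp: separating_def)
  have "s * D (f n) = 0" for n
    using D_separating[OF separating_mult[OF s f(1)], of n] D_separating[OF s] D_mult[OF sc f(1)]
    by simp
  moreover have "(\<lambda>n. s * D (f n)) \<longlonglongrightarrow> s * s"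
    using f by (intro tendsto_intros)
  ultimately have ss: "s * s = 0"
    by (simp add: LIMSEQ_const_iff)
  show ?thesis
  proof (rule zero_if_resolvent[OF sc])
    fix c
    have "(e - scaleC c s) * (e + scaleC c s) = e"
      using sc ss by (simp add: distrib_left left_diff_distrib mult_scaleC_left mult_scaleC_right
          unit_mult)
    then show "cinv (e - scaleC c s)"
      using sc by (auto simp: cinv_def intro!: bexI[of _ "e + scaleC c s"])
  qed
qed

lemma D_bounded_linear: "bounded_linear D"
proof (rule closed_graph_bounded_linear)
  show "linear D" by (intro linearI D_add D_scaleR)
  fix x y assume x: "x \<longlonglongrightarrow> 0" "(\<lambda>n. D (x n)) \<longlonglongrightarrow> y"
  have "(\<lambda>n. e * x n) \<longlonglongrightarrow> 0"
    using x by (intro tendsto_mult_right_zero)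
  then have "y \<in> separating"
    using x unfolding separating_def by (auto intro!: exI[of _ "\<lambda>n. e * x n"] simp: D_unit_mult)
  then show "y = 0" by (rule separating_zero)
qed

section \<open>The Kleinecke-Shirokov argument\<close>

text \<open>The commutator of left multiplication by \<open>a\<close> with the operator
  \<open>T\<close>.\<close>

definition ad :: "'a \<Rightarrow> ('a \<Rightarrow> 'a) \<Rightarrow> 'a \<Rightarrow> 'a" where
  "ad a T = (\<lambda>y. a * T y - T (a * y))"

lemma ad_pow_Suc: "(ad a ^^ Suc m) T y = a * (ad a ^^ m) T y - (ad a ^^ m) T (a * y)"
  by (simp add: ad_def)

lemma ad_pow_corner:
  assumes "a \<in> corner" "y \<in> corner"
  shows "(ad a ^^ m) (D ^^ n) y \<in> corner"
  using assms(2)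
proof (induction m arbitrary: y)
  case 0
  then show ?case by (cases n) auto
next
  case (Suc m)
  then show ?case using assms(1) by (simp only: ad_pow_Suc) simp
qed

text \<open>The Leibniz formula for the derivation \<open>ad a\<close> on the composition of
  \<open>D\<close> with \<open>D ^^ n\<close>. Only two terms survive: on the corner,
  \<open>ad a D\<close> is multiplication by \<open>- D a\<close>, which a further
  \<open>ad a\<close> kills.\<close>

lemma ad_pow_D_Suc:
  assumes a: "a \<in> corner" and y: "y \<in> corner"
  shows "(ad a ^^ m) (D ^^ Suc n) y =
    D ((ad a ^^ m) (D ^^ n) y) - real m *\<^sub>R (D a * (ad a ^^ (m - 1)) (D ^^ n) y)"
  using y
proof (induction m arbitrary: y)
  case (Suc m)
  let ?E = "(ad a ^^ m) (D ^^ n)" and ?E' = "(ad a ^^ (m - 1)) (D ^^ n)"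
  have Ec: "?E y \<in> corner" using a Suc.prems by (rule ad_pow_corner)
  have c: "a * (D a * w) = D a * (a * w)" for w
    using corner_comm[OF a D_corner, of a] by (metis mult.assoc)
  \<comment> \<open>For \<open>m = 0\<close> the exponent \<open>m - 1\<close> truncates to 0, and
    the factor \<open>real m\<close> makes both sides vanish.\<close>
  have m: "real m *\<^sub>R (a * ?E' y - ?E' (a * y)) = real m *\<^sub>R ?E y"
    by (cases m) (auto simp: ad_pow_Suc simp del: funpow.simps)
  have "(ad a ^^ Suc m) (D ^^ Suc n) y =
      a * (D (?E y) - real m *\<^sub>R (D a * ?E' y)) - (D (?E (a * y)) - real m *\<^sub>R (D a * ?E' (a * y)))"
    unfolding ad_pow_Suc using Suc a by (simp del: funpow.simps)
  also have "\<dots> = a * D (?E y) - D (?E (a * y)) - D a * (real m *\<^sub>R (a * ?E' y - ?E' (a * y)))"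
    by (simp add: right_diff_distrib scaleR_diff_right c)
  also have "\<dots> = D (a * ?E y - ?E (a * y)) - D a * ?E y - D a * (real m *\<^sub>R ?E y)"
    unfolding m using D_mult[OF a Ec] by (simp add: D_diff)
  also have "\<dots> = D (a * ?E y - ?E (a * y)) - real (Suc m) *\<^sub>R (D a * ?E y)"
    by (simp add: scaleR_add_left)
  finally show ?case
    unfolding ad_pow_Suc by simp
qed simp

text \<open>By induction \<open>(ad a ^^ n) (D ^^ n)\<close> is a multiplication on the corner and
  is killed by one more \<open>ad a\<close>; of the Leibniz formula with \<open>m = Suc n\<close>
  only the term with \<open>D a\<close> remains.\<close>

lemma ad_pow_D_diag:
  assumes a: "a \<in> corner" and y: "y \<in> corner"
  shows "(ad a ^^ n) (D ^^ n) y = fact n *\<^sub>R (pw (- D a) n * y)"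
  using y
proof (induction n arbitrary: y)
  case 0
  then show ?case by (simp add: unit_mult)
next
  case (Suc n)
  have "a * (pw (- D a) n * y) = pw (- D a) n * (a * y)"
    using corner_comm[OF a, of "pw (- D a) n"] by (metis D_corner corner_minus mult.assoc pw_corner)
  then have "(ad a ^^ Suc n) (D ^^ n) y = 0"
    unfolding ad_pow_Suc using Suc a by simp
  then have "(ad a ^^ Suc n) (D ^^ Suc n) y = - (real (Suc n) *\<^sub>R (D a * (fact n *\<^sub>R (pw (- D a) n * y))))"
    using ad_pow_D_Suc[OF a Suc.prems, of "Suc n" n] Suc by (simp del: funpow.simps)
  then show ?case
    by (simp add: pw_Suc mult.assoc del: funpow.simps)
qed

lemma norm_ad_pow_le:
  assumes "M \<ge> 0" "\<And>y. norm (D y) \<le> M * norm y"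
  shows "norm ((ad a ^^ m) (D ^^ n) y) \<le> (2 * norm a) ^ m * M ^ n * norm y"
proof (induction m arbitrary: y)
  case 0
  show ?case
  proof (induction n)
    case (Suc n)
    have "norm ((D ^^ Suc n) y) \<le> M * norm ((D ^^ n) y)"
      using assms(2) by simp
    also have "\<dots> \<le> M * (M ^ n * norm y)"
      using Suc assms(1) by (intro mult_left_mono) auto
    finally show ?case by (simp add: mult.assoc)
  qed simp
next
  case (Suc m)
  let ?E = "(ad a ^^ m) (D ^^ n)" and ?C = "(2 * norm a) ^ m * M ^ n"
  have C: "?C \<ge> 0" using assms(1) by simp
  have "norm (a * ?E y) \<le> norm a * (?C * norm y)"
    by (intro order_trans[OF norm_mult_ineq] mult_left_mono Suc) auto
  moreover have "norm (?E (a * y)) \<le> ?C * (norm a * norm y)"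
    by (intro order_trans[OF Suc] mult_left_mono norm_mult_ineq C)
  ultimately show ?case
    unfolding ad_pow_Suc using norm_triangle_ineq4[of "a * ?E y" "?E (a * y)"]
    by (simp add: algebra_simps)
qed

text \<open>Kleinecke-Shirokov: \<open>ad a\<close> is a derivation on operators that maps \<open>D\<close> to the multiplication by
  \<open>- D a\<close>, on which it vanishes, so \<open>ad a\<close> applied \<open>n\<close> times to \<open>D ^^ n\<close> is \<open>n!\<close> times the multiplication
  by \<open>(- D a)\<^sup>n\<close>. Hence \<open>D a\<close> is quasinilpotent.\<close>
lemma D_eq_zero_corner:
  assumes a: "a \<in> corner"
  shows "D a = 0"
proof (rule zero_if_resolvent)
  fix c
  obtain M where M: "M \<ge> 0" "\<And>y. norm (D y) \<le> M * norm y"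
    using bounded_linear.nonneg_bounded[OF D_bounded_linear] by (auto simp: mult.commute)
  \<comment> \<open>Up to the factor \<open>norm e\<close> these are the terms of an exponential
    series; they will dominate the powers of \<open>scaleC c (D a)\<close>.\<close>
  have "(\<lambda>n. (cmod c * (2 * norm a * M)) ^ n / fact n * norm e) \<longlonglongrightarrow> 0"
    by (intro tendsto_mult_left_zero summable_LIMSEQ_zero)
      (use summable_exp[of "cmod c * (2 * norm a * M)"] in \<open>simp add: field_simps\<close>)
  then have "\<forall>\<^sub>F n in sequentially. (cmod c * (2 * norm a * M)) ^ n / fact n * norm e < 1"
    by (rule order_tendstoD) simp
  then obtain n where n: "(cmod c * (2 * norm a * M)) ^ n / fact n * norm e < 1"
    by (auto simp: eventually_sequentially)
  have "fact n * norm (pw (- D a) n) \<le> (2 * norm a) ^ n * M ^ n * norm e"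
    using norm_ad_pow_le[OF M, where a=a and m=n and n=n and y=e] ad_pow_D_diag[OF a, of e n] by simp
  then have "norm (pw (- D a) n) \<le> (2 * norm a * M) ^ n / fact n * norm e"
    by (simp add: field_simps power_mult_distrib)
  then have "cmod c ^ n * norm (pw (- D a) n) \<le> cmod c ^ n * ((2 * norm a * M) ^ n / fact n * norm e)"
    by (intro mult_left_mono) auto
  moreover have "scaleC c (D a) = scaleC (- c) (- D a)"
    by (simp add: scaleC_minus_left scaleC_minus_right)
  then have "norm (pw (scaleC c (D a)) n) = cmod c ^ n * norm (pw (- D a) n)"
    by (simp add: pw_scaleC norm_scaleC norm_power)
  ultimately have "norm (pw (scaleC c (D a)) n) \<le> (cmod c * (2 * norm a * M)) ^ n / fact n * norm e"
    by (simp add: power_mult_distrib mult_ac)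
  with n have "norm (pw (scaleC c (D a)) n) < 1"
    by linarith
  then show "cinv (e - scaleC c (D a))"
    by (intro cinv_unit_minus_pw_small[of _ n]) auto
qed simp

lemma D_eq_zero: "D x = 0"
  using D_eq_zero_corner[of "e * x"] by (simp add: D_unit_mult)

end

section \<open>From the corner back to the algebra\<close>

text \<open>The corner meets \<open>rad A = rann A\<close> only in 0, so
  \<open>x \<mapsto> e * d x\<close> is a derivation of a semisimple corner and vanishes; then
  \<open>a * d x = a * (e * d x) = 0\<close>.\<close>

lemma derivation_into_rann:
  fixes d :: "'a::complex_banach_algebra \<Rightarrow> 'a"
  assumes rad: "(jac_rad :: 'a set) = rann"
    and comm: "\<forall>a b :: 'a. a * b - b * a \<in> jac_rad"
    and e: "\<And>a::'a. a * e = a"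
    and d: "derivation d"
  shows "a * d x = 0"
proof -
  have d_add: "d (x + y) = d x + d y" and d_scaleC: "d (scaleC c x) = scaleC c (d x)"
    and d_mult: "d (x * y) = d x * y + x * d y" for x y c
    using d by (auto simp: derivation_def)
  have d_diff: "d (x - y) = d x - d y" for x y
    using d_add[of "x - y" y] by simp
  have comm': "z * (x * y) = z * (y * x)" for x y z :: 'a
    using comm unfolding rad rann_def by (auto simp: right_diff_distrib)
  interpret right_unital_algebra e
    by unfold_locales (use e comm' in auto)
  \<comment> \<open>\<open>d\<close> maps \<open>rann\<close> into itself: differentiate
    \<open>a * r = 0\<close>.\<close>
  have rann: "a * d r = 0" if "r \<in> rann" for a r
  proof -
    have r: "b * r = 0" for b using that by (simp add: rann_def)
    have "d (a * r) = d a * r + a * d r" by (rule d_mult)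
    moreover have "d 0 = 0" using d_add[of 0 0] by simp
    ultimately show ?thesis using r by simp
  qed
  interpret semisimple_derivation e "\<lambda>x. e * d x"
  proof unfold_locales
    show "x = 0" if "x \<in> corner" "x \<in> jac_rad" for x
      using that unfolding rad rann_def by (auto simp: corner_def)
    show "e * d (x * y) = e * d x * y + x * (e * d y)" if "x \<in> corner" "y \<in> corner" for x y
    proof -
      have "e * (x * d y) = x * (e * d y)"
        using unit_mult[OF that(1)] e by (metis mult.assoc)
      then show ?thesis by (simp add: d_mult distrib_left mult.assoc)
    qed
    show "e * d (e * x) = e * d x" for x
    proof -
      have "b * (e * x) = b * x" for b using e by (metis mult.assoc)
      then have "e * x - x \<in> rann"
        by (simp add: rann_def right_diff_distrib)
      from rann[OF this, of e] show ?thesis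
        by (simp add: d_diff right_diff_distrib)
    qed
  qed (auto simp: d_add d_scaleC distrib_left mult_scaleC_right)
  have "a * d x = a * e * d x" by (simp add: e)
  also have "\<dots> = 0" using D_eq_zero[of x] by (simp only: mult.assoc mult_zero_right)
  finally show ?thesis .
qed

lemma npow_idempotent: "a * a = a \<Longrightarrow> k \<ge> 1 \<Longrightarrow> npow a k = a"
  by (induction a k rule: npow.induct) auto

text \<open>For an idempotent \<open>a\<close> the hypothesis reduces to \<open>d a * a = 0\<close>,
  as \<open>a * d a = 0\<close> already. At \<open>e\<close> this gives \<open>d e = 0\<close>, at
  the idempotent \<open>e + r\<close> it gives \<open>d r = 0\<close>; the decomposition
  \<open>x = e * x + r\<close> finishes the proof.\<close>

lemma k_commuting_imp_zero:
  fixes d :: "'a::complex_banach_algebra \<Rightarrow> 'a"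
  assumes e: "\<And>a::'a. a * e = a" and d: "derivation d" and ann: "\<And>a x. a * d x = 0"
    and k: "k \<ge> 1" and com: "k_commuting k d"
  shows "d x = 0"
proof -
  have d_add: "d (x + y) = d x + d y" and d_mult: "d (x * y) = d x * y + x * d y" for x y
    using d by (auto simp: derivation_def)
  have *: "d a * a = 0" if "a * a = a" for a
    using com npow_idempotent[OF that k] ann[of "npow a k" a]
    by (auto simp: k_commuting_def commutator_def dest: spec[of _ a])
  have de: "d e = 0"
    using *[of e] by (simp add: e)
  define r where "r = x - e * x"
  have r: "b * r = 0" for b
    using e by (simp add: r_def right_diff_distrib mult.assoc[symmetric])
  have "(e + r) * (e + r) = e + r"
    using r e by (simp add: distrib_left distrib_right)
  from *[OF this] have "d r = 0"
    using r e by (simp add: d_add de distrib_left)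
  moreover have "d (e * x) = 0"
    by (simp add: d_mult de ann)
  moreover have "d x = d r + d (e * x)"
    by (simp add: d_add[symmetric] r_def)
  ultimately show ?thesis by simp
qed

theorem theorem4p1:
  fixes d :: "'a::complex_banach_algebra \<Rightarrow> 'a" and k :: nat
  assumes "(jac_rad :: 'a set) = rann"
    and "\<forall>a b :: 'a. a * b - b * a \<in> jac_rad"
    and "\<exists>e :: 'a. \<forall>a. a * e = a"
    and "derivation d"
    and "k \<ge> 1"
  shows "(d = (\<lambda>_. 0) \<longleftrightarrow> k_centralizing k d) \<and> (k_centralizing k d \<longleftrightarrow> k_commuting k d)"
proof -
  obtain e :: 'a where e: "\<And>a. a * e = a"
    using assms(3) by blast
  have "d = (\<lambda>_. 0)" if "k_commuting k d"
    using k_commuting_imp_zero[OF e assms(4) derivation_into_rann[OF assms(1,2) e assms(4)] assms(5) that]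
    by blast
  moreover have "k_commuting k d" if "k_centralizing k d"
  proof -
    \<comment> \<open>The commutators in question lie in \<open>rann\<close>, which meets the center
      only in 0: \<open>z = z * e = e * z = 0\<close>.\<close>
    have "z = 0" if "z \<in> alg_center" "z \<in> rann" for z :: 'a
    proof -
      have "z * e = e * z" "e * z = 0"
        using that by (auto simp: alg_center_def rann_def)
      then show ?thesis using e[of z] by simp
    qed
    then show ?thesis
      using that assms(1,2) unfolding k_centralizing_def k_commuting_def commutator_def by blast
  qed
  moreover have "k_centralizing k d" if "d = (\<lambda>_. 0)"
    using that by (simp add: k_centralizing_def commutator_def alg_center_def)
  ultimately show ?thesis by blast
qed

end
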